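(* For every integer $n\ge 0$ let $T_n$ be the $n$-twist loop and $T_n(x)$ its generating polynomial (with $T_0$ the unknot, $T_0(x)=x$). Then $T_n(x)$ satisfies the recurrence $$T_n(x)=(x+1)\,T_{n-1}(x)\qquad (n\ge 1),$$ and is given by the closed form $$T_n(x)=x(x+1)^n\qquad (n\ge 0).$$
   Context: A knot (diagram) means a shadow on the sphere $S^2$: a finite collection of closed curves whose only singularities are finitely many transverse double points, called crossings, with no over/under information, considered up to planar isotopy (several components and crossingless circles are allowed). The unknot $U$ is a single simple closed curve. Each crossing can be split in two ways: remove the crossing and reconnect the four ends in one of the two planar non-crossing ways that join adjacent ends (type $0$ and type $1$ splits). A state of a knot $K$ with $m$ crossings is one of the $2^m$ diagrams obtained by choosing a split at each crossing; it is a disjoint union of simple closed curves (circles), and $|S|$ denotes the number of circles of the state $S$. The generating polynomial of $K$ is $K(x)=\sum_S x^{|S|}$, summed over all $2^m$ states. The $n$-twist loop $T_n$ is the shadow obtained by giving the unknot $n$ half twists: take $n$ crossings placed in a horizontal row, join the two right ends of each crossing to the two left ends (upper to upper, lower to lower) of the next one, and join together the two left ends of the first crossing and the two right ends of the last crossing. $T_0=U$. Equivalently $T_n$ is the connected sum of $n$ copies of $T_1$ (the one-crossing figure-eight curve). *)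

theory Defs
  imports "HOL-Computational_Algebra.Polynomial" "HOL-Library.FuncSet"
begin

text \<open>
  A shadow on the sphere is encoded by its combinatorial map.  Every crossing has four ends, named
  after the corners of a crossing drawn as the letter X, and \<open>arc\<close> sends an end to the other end
  of the arc of the shadow that leaves the crossing there.  Closed curves without crossings carry no
  end and are only counted, by \<open>loops\<close>.
\<close>

datatype corner = NW | SW | SE | NE

record 'c diagram =
  crossings :: "'c set"
  arc :: "'c \<times> corner \<Rightarrow> 'c \<times> corner"
  loops :: nat

definition ends :: "'c diagram \<Rightarrow> ('c \<times> corner) set" where
  "ends K = crossings K \<times> UNIV"

text \<open>The next end counterclockwise around the same crossing.\<close>

fun rot :: "'c \<times> corner \<Rightarrow> 'c \<times> corner" where
  "rot (c, NW) = (c, SW)"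
| "rot (c, SW) = (c, SE)"
| "rot (c, SE) = (c, NE)"
| "rot (c, NE) = (c, NW)"

text \<open>The classes, on \<open>A\<close>, of the equivalence relation generated by \<open>R\<close>.\<close>

definition classes :: "'a set \<Rightarrow> ('a \<times> 'a) set \<Rightarrow> 'a set set" where
  "classes A R = A // (R \<union> R\<inverse>)\<^sup>*"

definition faces :: "'c diagram \<Rightarrow> ('c \<times> corner) set set" where
  "faces K = classes (ends K) {(e, rot (arc K e)) | e. e \<in> ends K}"

definition components :: "'c diagram \<Rightarrow> ('c \<times> corner) set set" where
  "components K = classes (ends K)
     ({(e, arc K e) | e. e \<in> ends K} \<union> {(e, rot e) | e. e \<in> ends K})"

text \<open>
  The last condition is Euler's formula \<open>V - E + F = 2 C\<close> with \<open>E = 2 V\<close>: the combinatorial map has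
  genus 0, i.e. it is drawn on the sphere.
\<close>

definition shadow :: "'c diagram \<Rightarrow> bool" where
  "shadow K \<longleftrightarrow>
     finite (crossings K) \<and>
     (\<forall>e \<in> ends K. arc K e \<in> ends K \<and> arc K e \<noteq> e \<and> arc K (arc K e) = e) \<and>
     card (faces K) = card (crossings K) + 2 * card (components K)"

datatype split = Split0 | Split1

text \<open>The end to which a given end is reconnected by a split of its crossing.\<close>

fun joined :: "split \<Rightarrow> corner \<Rightarrow> corner" where
  "joined Split0 NW = NE"
| "joined Split0 NE = NW"
| "joined Split0 SW = SE"
| "joined Split0 SE = SW"
| "joined Split1 NW = SW"
| "joined Split1 SW = NW"
| "joined Split1 NE = SE"
| "joined Split1 SE = NE"

definition states :: "'c diagram \<Rightarrow> ('c \<Rightarrow> split) set" where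
  "states K = crossings K \<rightarrow>\<^sub>E UNIV"

text \<open>A circle of a state is given by the set of ends of crossings that it passes through.\<close>

definition circles :: "'c diagram \<Rightarrow> ('c \<Rightarrow> split) \<Rightarrow> ('c \<times> corner) set set" where
  "circles K S = classes (ends K)
     ({(e, arc K e) | e. e \<in> ends K} \<union> {((c, k), (c, joined (S c) k)) | c k. c \<in> crossings K})"

definition num_circles :: "'c diagram \<Rightarrow> ('c \<Rightarrow> split) \<Rightarrow> nat" where
  "num_circles K S = card (circles K S) + loops K"

definition gen_poly :: "'c diagram \<Rightarrow> int poly" where
  "gen_poly K = (\<Sum>S \<in> states K. monom 1 (num_circles K S))"

definition unknot :: "'c diagram" where
  "unknot = \<lparr>crossings = {}, arc = id, loops = 1\<rparr>"

text \<open>The crossings of the twist loop are numbered from left to right.\<close>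

fun twist_arc :: "nat \<Rightarrow> nat \<times> corner \<Rightarrow> nat \<times> corner" where
  "twist_arc n (i, NE) = (if Suc i < n then (Suc i, NW) else (i, SE))"
| "twist_arc n (i, SE) = (if Suc i < n then (Suc i, SW) else (i, NE))"
| "twist_arc n (i, NW) = (if i = 0 then (i, SW) else (i - 1, NE))"
| "twist_arc n (i, SW) = (if i = 0 then (i, NW) else (i - 1, SE))"

definition twist_loop :: "nat \<Rightarrow> nat diagram" where
  "twist_loop n =
     (if n = 0 then unknot else \<lparr>crossings = {..<n}, arc = twist_arc n, loops = 0\<rparr>)"

lemma card_classes:
  assumes inv: "\<And>a b. (a, b) \<in> R \<Longrightarrow> f a = f b"
    and rep: "\<And>a. a \<in> A \<Longrightarrow> (a, r (f a)) \<in> (R \<union> R\<inverse>)\<^sup>*"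
  shows "card (classes A R) = card (f ` A)"
proof -
  let ?E = "(R \<union> R\<inverse>)\<^sup>*"
  have sym: "sym ?E" by (intro sym_rtrancl sym_Un_converse)
  have f: "f a = f b" if "(a, b) \<in> ?E" for a b
    using that by (induction rule: rtrancl_induct) (auto dest: inv)
  have E: "(a, b) \<in> ?E \<longleftrightarrow> f a = f b" if "a \<in> A" "b \<in> A" for a b
    using that f rep sym by (metis rtrancl_trans symD)
  have eq: "equiv UNIV ?E"
    using sym by (auto simp: equiv_def refl_on_def trans_rtrancl)
  have "bij_betw (\<lambda>y. ?E `` {SOME a. a \<in> A \<and> f a = y}) (f ` A) (classes A R)"
    (is "bij_betw ?g _ _")
  proof -
    have g: "?g (f a) = ?E `` {a}" if "a \<in> A" for a
    proof -
      have "(SOME b. b \<in> A \<and> f b = f a) \<in> A \<and> f (SOME b. b \<in> A \<and> f b = f a) = f a"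
        using that by (intro someI[of "\<lambda>b. b \<in> A \<and> f b = f a"]) simp
      then show ?thesis
        using that E eq by (metis equiv_class_eq)
    qed
    have "inj_on ?g (f ` A)"
    proof (rule inj_onI)
      fix y z assume "y \<in> f ` A" "z \<in> f ` A" and yz: "?g y = ?g z"
      then obtain a b where ab: "a \<in> A" "b \<in> A" and y: "y = f a" and z: "z = f b" by auto
      have "?E `` {a} = ?E `` {b}"
        using yz unfolding y z g[OF ab(1)] g[OF ab(2)] .
      then have "(a, b) \<in> ?E" by auto
      then show "y = z" unfolding y z by (rule f)
    qed
    moreover have "?g ` (f ` A) = classes A R"
      using g by (auto simp: classes_def quotient_def image_iff)
    ultimately show ?thesis by (simp add: bij_betw_def)
  qed
  then show ?thesis by (rule bij_betw_same_card[symmetric])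
qed

lemma card_faces_twist_loop:
  assumes "0 < n"
  shows "card (faces (twist_loop n)) = n + 2"
proof -
  define A where "A = {..<n} \<times> (UNIV :: corner set)"
  define R where "R = {(e, rot (twist_arc n e)) | e. e \<in> A}"
  define f where "f = (\<lambda>(i, k). case k of NE \<Rightarrow> Suc i | SW \<Rightarrow> i | _ \<Rightarrow> n + 1)"
  define r where "r = (\<lambda>y. if y = 0 then (0, SW) else if y = n + 1 then (0, SE) else (y - 1, NE))"
  let ?E = "(R \<union> R\<inverse>)\<^sup>*"
  have sym: "(b, a) \<in> ?E" if "(a, b) \<in> ?E" for a b
    using that by (meson sym_rtrancl sym_Un_converse symD)
  have R: "(e, rot (twist_arc n e)) \<in> ?E" if "e \<in> A" for e
    using that unfolding R_def by blast
  have SE: "((i, SE), (0, SE)) \<in> ?E" if "i < n" for i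
    using that
  proof (induction i)
    case (Suc i)
    then have "((i, SE), (Suc i, SE)) \<in> ?E" using R[of "(i, SE)"] by (auto simp: A_def)
    with Suc show ?case by (meson rtrancl_trans sym Suc_lessD)
  qed simp
  have NW: "((i, NW), (0, SE)) \<in> ?E" if "i < n" for i
    using that
  proof (induction i)
    case 0
    then show ?case using R[of "(0, NW)"] by (auto simp: A_def)
  next
    case (Suc i)
    then have "((Suc i, NW), (i, NW)) \<in> ?E" using R[of "(Suc i, NW)"] by (auto simp: A_def)
    with Suc show ?case by (meson rtrancl_trans Suc_lessD)
  qed
  have "card (classes A R) = card (f ` A)"
  proof (rule card_classes[where r = r])
    show "f a = f b" if "(a, b) \<in> R" for a b
    proof -
      obtain i k where "a = (i, k)" by (cases a)
      with that assms show ?thesis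
        by (cases k) (auto simp: R_def A_def f_def split: if_splits)
    qed
  next
    fix a assume a: "a \<in> A"
    obtain i k where ik: "a = (i, k)" by (cases a)
    have i: "i < n" using a ik by (simp add: A_def)
    show "(a, r (f a)) \<in> ?E"
    proof (cases k)
      case SW
      show ?thesis
        using i R[of "(i, SW)"] by (cases i) (auto simp: ik SW f_def r_def A_def)
    qed (use i SE NW in \<open>auto simp: ik f_def r_def\<close>)
  qed
  also have "f ` A = {..n + 1}"
  proof
    show "f ` A \<subseteq> {..n + 1}" by (auto simp: f_def A_def split: corner.splits)
    show "{..n + 1} \<subseteq> f ` A"
    proof
      fix y assume y: "y \<in> {..n + 1}"
      have "f (r y) = y" by (auto simp: f_def r_def)
      moreover have "r y \<in> A" using y assms by (auto simp: r_def A_def)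
      ultimately show "y \<in> f ` A" by (metis imageI)
    qed
  qed
  finally show ?thesis
    using assms by (simp add: faces_def twist_loop_def ends_def A_def R_def)
qed

lemma card_components_twist_loop:
  assumes "0 < n"
  shows "card (components (twist_loop n)) = 1"
proof -
  define A where "A = {..<n} \<times> (UNIV :: corner set)"
  define R where "R = {(e, twist_arc n e) | e. e \<in> A} \<union> {(e, rot e) | e. e \<in> A}"
  let ?E = "(R \<union> R\<inverse>)\<^sup>*"
  have arc: "(e, twist_arc n e) \<in> ?E" and rot: "(e, rot e) \<in> ?E" if "e \<in> A" for e
    using that unfolding R_def by blast+
  have NW: "((i, k), (i, NW)) \<in> ?E" if "i < n" for i k
  proof -
    have "((i, SW), (i, SE)) \<in> ?E" "((i, SE), (i, NE)) \<in> ?E" "((i, NE), (i, NW)) \<in> ?E"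
      using that rot[of "(i, SW)"] rot[of "(i, SE)"] rot[of "(i, NE)"] by (auto simp: A_def)
    then show ?thesis by (cases k) (simp, (meson rtrancl_trans)+)
  qed
  have NW0: "((i, NW), (0, NW)) \<in> ?E" if "i < n" for i
    using that
  proof (induction i)
    case (Suc i)
    then have "((Suc i, NW), (i, NE)) \<in> ?E" using arc[of "(Suc i, NW)"] by (auto simp: A_def)
    with Suc NW show ?case by (meson rtrancl_trans Suc_lessD)
  qed simp
  have "card (classes A R) = card ((\<lambda>_. True) ` A)"
  proof (rule card_classes[where r = "\<lambda>_. (0, NW)"])
    fix a assume "a \<in> A"
    then obtain i k where "a = (i, k)" "i < n" by (auto simp: A_def)
    then show "(a, (0, NW)) \<in> ?E"
      using rtrancl_trans[OF NW NW0] by simp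
  qed simp
  also have "(\<lambda>_. True) ` A = {True}"
    using assms by (auto simp: A_def)
  finally show ?thesis
    using assms by (simp add: components_def twist_loop_def ends_def A_def R_def)
qed

lemma shadow_twist_loop: "shadow (twist_loop n)"
proof (cases "n = 0")
  case True
  then show ?thesis
    by (simp add: shadow_def twist_loop_def unknot_def ends_def faces_def components_def classes_def)
next
  case False
  have "arc (twist_loop n) e \<in> ends (twist_loop n) \<and> arc (twist_loop n) e \<noteq> e \<and>
      arc (twist_loop n) (arc (twist_loop n) e) = e" if "e \<in> ends (twist_loop n)" for e
  proof -
    obtain i k where "e = (i, k)" by (cases e)
    with that False show ?thesis
      by (cases k) (auto simp: twist_loop_def ends_def)
  qed
  with False show ?thesis
    by (simp add: shadow_def card_faces_twist_loop card_components_twist_loop)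
      (simp add: twist_loop_def)
qed

end

theory Submission
  imports Defs
begin

text \<open>
  Split 0 of a crossing in the row lets the upper and the lower strand run on, split 1 cuts the row
  there and caps off both sides.  A state with \<open>k\<close> splits of type 1 therefore cuts the band between
  the upper and the lower strand into \<open>k + 1\<close> pieces, each bounded by exactly one circle
  (\<open>num_circles_twist_loop\<close>).  Hence \<open>T\<^sub>n(x)\<close> is the sum of \<open>x\<^bsup>k + 1\<^esup>\<close> over all choices of a split at
  each of the \<open>n\<close> crossings.  Distributivity turns this sum into a product in which every crossing
  contributes the factor \<open>1 + x\<close>, and the recurrence can be read off from the closed form.

  To count circles, \<open>card_classes\<close> is applied with the invariant that sends an end to the number of
  cuts to its left: arcs and splits join only ends with the same such number, and ends with the same number of cuts
  to their left lie on the same circle.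
\<close>

definition cuts :: "(nat \<Rightarrow> split) \<Rightarrow> nat \<Rightarrow> nat" where
  "cuts S i = card {j. j < i \<and> S j = Split1}"

lemma cuts_0 [simp]: "cuts S 0 = 0"
  by (simp add: cuts_def)

lemma cuts_Suc [simp]: "cuts S (Suc i) = (if S i = Split1 then Suc (cuts S i) else cuts S i)"
proof -
  have "{j. j < Suc i \<and> S j = Split1} =
      (if S i = Split1 then insert i {j. j < i \<and> S j = Split1} else {j. j < i \<and> S j = Split1})"
    by (auto simp: less_Suc_eq)
  then show ?thesis by (simp add: cuts_def)
qed

lemma mono_cuts: "mono (cuts S)"
  by (rule mono_iff_le_Suc[THEN iffD2]) simp

lemma image_cuts: "cuts S ` {..n} = {..cuts S n}"
  by (induction n) (auto simp: atMost_Suc)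

text \<open>
  The ends between crossings \<open>i - 1\<close> and \<open>i\<close> have \<open>cuts S i\<close> cuts to their left.  The representative
  of a circle is its leftmost upper end: \<open>(0, NW)\<close>, or the north-east end of the crossing whose cut
  starts the circle.
\<close>

lemma num_circles_twist_loop: "num_circles (twist_loop n) S = Suc (cuts S n)"
proof (cases "n = 0")
  case True
  then show ?thesis
    by (simp add: num_circles_def circles_def classes_def ends_def twist_loop_def unknot_def)
next
  case False
  define A where "A = {..<n} \<times> (UNIV :: corner set)"
  define R where "R = {(e, twist_arc n e) | e. e \<in> A} \<union>
    {((c, k), (c, joined (S c) k)) | c k. c \<in> {..<n}}"
  define gap where "gap = (\<lambda>(i :: nat, k). if k = NW \<or> k = SW then i else Suc i)"
  define r where "r = (\<lambda>y. if y = 0 then (0, NW) else (LEAST i. cuts S (Suc i) = y, NE))"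
  let ?E = "(R \<union> R\<inverse>)\<^sup>*"
  have arc: "((i, k), twist_arc n (i, k)) \<in> ?E" if "i < n" for i k
    using that unfolding R_def A_def by blast
  have joined: "((i, k), (i, joined (S i) k)) \<in> ?E" if "i < n" for i k
    using that unfolding R_def by blast
  have r_cut: "r (cuts S (Suc i)) = (i, NE)" if "S i = Split1" for i
  proof -
    have "(LEAST j. cuts S (Suc j) = cuts S (Suc i)) = i"
    proof (rule Least_equality)
      fix j assume j: "cuts S (Suc j) = cuts S (Suc i)"
      show "i \<le> j"
      proof (rule ccontr)
        assume "\<not> i \<le> j"
        then have "cuts S (Suc j) \<le> cuts S i" by (intro monoD[OF mono_cuts]) simp
        with j that show False by simp
      qed
    qed simp
    with that show ?thesis by (simp add: r_def)
  qed
  have upper: "((i, NW), r (cuts S i)) \<in> ?E \<and> ((i, NE), r (cuts S (Suc i))) \<in> ?E" if "i < n" for i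
    using that
  proof (induction i)
    case 0
    then show ?case
      using joined[of 0 NE] r_cut[of 0] by (cases "S 0") (auto simp: r_def)
  next
    case (Suc i)
    have "((Suc i, NW), (i, NE)) \<in> ?E" using arc[OF Suc.prems, of NW] by simp
    then have NW: "((Suc i, NW), r (cuts S (Suc i))) \<in> ?E"
      using Suc by (meson rtrancl_trans Suc_lessD)
    have "((Suc i, NE), r (cuts S (Suc (Suc i)))) \<in> ?E"
    proof (cases "S (Suc i)")
      case Split0
      then have "((Suc i, NE), (Suc i, NW)) \<in> ?E" using joined[OF Suc.prems, of NE] by simp
      from rtrancl_trans[OF this NW] Split0 show ?thesis by simp
    next
      case Split1
      then show ?thesis by (simp only: r_cut rtrancl.rtrancl_refl)
    qed
    with NW show ?case ..
  qed
  \<comment> \<open>A lower end reaches the upper end above it through the nearest cap on its left.\<close>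
  have lower: "((i, SW), (i, NW)) \<in> ?E \<and> ((i, SE), (i, NE)) \<in> ?E" if "i < n" for i
    using that
  proof (induction i)
    case 0
    have SW: "((0, SW), (0, NW)) \<in> ?E" using arc[OF 0, of SW] by simp
    have "((0, SE), (0, NE)) \<in> ?E"
    proof (cases "S 0")
      case Split0
      then have "((0, SE), (0, SW)) \<in> ?E" "((0, NW), (0, NE)) \<in> ?E"
        using joined[OF 0, of SE] joined[OF 0, of NW] by simp_all
      with SW show ?thesis by (meson rtrancl_trans)
    next
      case Split1
      then show ?thesis using joined[OF 0, of SE] by simp
    qed
    with SW show ?case ..
  next
    case (Suc i)
    have "((Suc i, SW), (i, SE)) \<in> ?E" "((i, NE), (Suc i, NW)) \<in> ?E"
      using arc[OF Suc.prems, of SW] arc[of i NE] Suc.prems by simp_all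
    with Suc have SW: "((Suc i, SW), (Suc i, NW)) \<in> ?E" by (meson rtrancl_trans Suc_lessD)
    have "((Suc i, SE), (Suc i, NE)) \<in> ?E"
    proof (cases "S (Suc i)")
      case Split0
      then have "((Suc i, SE), (Suc i, SW)) \<in> ?E" "((Suc i, NW), (Suc i, NE)) \<in> ?E"
        using joined[OF Suc.prems, of SE] joined[OF Suc.prems, of NW] by simp_all
      with SW show ?thesis by (meson rtrancl_trans)
    next
      case Split1
      then show ?thesis using joined[OF Suc.prems, of SE] by simp
    qed
    with SW show ?case ..
  qed
  have "card (classes A R) = card ((\<lambda>e. cuts S (gap e)) ` A)"
  proof (rule card_classes[where r = r])
    fix a b assume ab: "(a, b) \<in> R"
    obtain i k where ik: "a = (i, k)" by (cases a)
    from ab consider "i < n" "b = twist_arc n (i, k)" | "b = (i, joined (S i) k)"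
      by (auto simp: R_def A_def ik)
    then show "cuts S (gap a) = cuts S (gap b)"
    proof cases
      case 1
      then show ?thesis by (cases k; cases i) (auto simp: ik gap_def)
    next
      case 2
      then show ?thesis by (cases "S i"; cases k) (auto simp: ik gap_def)
    qed
  next
    fix a assume "a \<in> A"
    then obtain i k where a: "a = (i, k)" and i: "i < n" by (auto simp: A_def)
    show "(a, r (cuts S (gap a))) \<in> ?E"
      using upper[OF i] lower[OF i] unfolding a gap_def
      by (cases k) (auto simp del: cuts_Suc intro: rtrancl_trans)
  qed
  also have "(\<lambda>e. cuts S (gap e)) ` A = cuts S ` {..n}"
  proof -
    have "gap ` A = {..n}"
    proof
      show "gap ` A \<subseteq> {..n}" by (auto simp: gap_def A_def)
      show "{..n} \<subseteq> gap ` A"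
      proof
        fix i assume i: "i \<in> {..n}"
        show "i \<in> gap ` A"
        proof (cases i)
          case 0
          then have "i = gap (0, NW)" "(0, NW) \<in> A" using False by (simp_all add: gap_def A_def)
          then show ?thesis by (rule image_eqI)
        next
          case (Suc j)
          then have "i = gap (j, NE)" "(j, NE) \<in> A" using i by (simp_all add: gap_def A_def)
          then show ?thesis by (rule image_eqI)
        qed
      qed
    qed
    then show ?thesis by (metis image_image)
  qed
  finally have "card (classes A R) = Suc (cuts S n)" by (simp add: image_cuts)
  then show ?thesis
    using False by (simp add: num_circles_def circles_def twist_loop_def ends_def A_def R_def)
qed

lemma monom_cuts: "monom 1 (cuts S n) = (\<Prod>i<n. if S i = Split1 then [:0, 1:] else (1 :: int poly))"
  by (induction n) (simp_all add: monom_Suc mult.commute)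

lemma gen_poly_twist_loop: "gen_poly (twist_loop n) = [:0, 1:] * ([:0, 1:] + 1) ^ n"
proof -
  have UNIV_split: "(UNIV :: split set) = {Split0, Split1}"
    using split.exhaust by auto
  have "gen_poly (twist_loop n) = (\<Sum>S \<in> {..<n} \<rightarrow>\<^sub>E UNIV. monom 1 (Suc (cuts S n)))"
    by (simp add: gen_poly_def states_def num_circles_twist_loop)
      (simp add: twist_loop_def unknot_def)
  also have "\<dots> = [:0, 1:] * (\<Sum>S \<in> {..<n} \<rightarrow>\<^sub>E UNIV. monom 1 (cuts S n))"
    by (simp add: sum_distrib_left monom_Suc)
  also have "(\<Sum>S \<in> {..<n} \<rightarrow>\<^sub>E UNIV. monom (1 :: int) (cuts S n)) =
      (\<Prod>i<n. \<Sum>s \<in> UNIV. if s = Split1 then [:0, 1:] else 1)"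
    unfolding monom_cuts by (rule prod_sum_PiE[symmetric]) (simp_all add: UNIV_split)
  also have "\<dots> = ([:0, 1:] + 1) ^ n"
    by (simp add: UNIV_split add.commute)
  finally show ?thesis .
qed

theorem theorem24:
  "twist_loop 0 = unknot \<and>
   gen_poly (twist_loop 0) = [:0, 1:] \<and>
   (\<forall>n \<ge> 1. gen_poly (twist_loop n) = ([:0, 1:] + 1) * gen_poly (twist_loop (n - 1))) \<and>
   (\<forall>n. gen_poly (twist_loop n) = [:0, 1:] * ([:0, 1:] + 1) ^ n)"
proof (intro conjI allI impI)
  show "twist_loop 0 = unknot" by (simp add: twist_loop_def)
  show "gen_poly (twist_loop 0) = [:0, 1:]" by (simp add: gen_poly_twist_loop)
next
  fix n :: nat assume "n \<ge> 1"
  then obtain m where "n = Suc m" by (cases n) auto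
  then show "gen_poly (twist_loop n) = ([:0, 1:] + 1) * gen_poly (twist_loop (n - 1))"
    by (simp only: gen_poly_twist_loop power_Suc diff_Suc_1 mult.left_commute)
qed (rule gen_poly_twist_loop)

end
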